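(* Suppose that $s,k\in\mathbb N$. Then \[ \max_{\mathbf h\in\mathbb Z^k\setminus\{\mathbf 0\}}J_{s,k}(X;\mathbf h)\gg X^{s-1}. \]
   Context: For $k,s\in\mathbb N$ and $\mathbf h\in\mathbb Z^k$, $J_{s,k}(X;\mathbf h)$ denotes the number of integral solutions $(x_1,\ldots,x_s,y_1,\ldots,y_s)$ of the system $\sum_{i=1}^s(x_i^j-y_i^j)=h_j$ $(1\le j\le k)$ with $1\le x_i,y_i\le X$ for all $i$. Here $X$ is a sufficiently large positive real number, and the constant implicit in $\gg$ may depend on $k$ and $s$ (only). *)

theory Defs
  imports Complex_Main "HOL-Library.FuncSet" "HOL-Library.Landau_Symbols"
begin

text \<open>
  Tuples $(a_1,\ldots,a_n)$ are extensional functions on the index set \<open>{1..n}\<close>, so that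
  equality of functions is equality of tuples and the cardinality below counts tuples.
\<close>

definition zero_tuple :: "nat \<Rightarrow> nat \<Rightarrow> int" where
  "zero_tuple k = (\<lambda>j\<in>{1..k}. 0)"

definition nonzero_tuples :: "nat \<Rightarrow> (nat \<Rightarrow> int) set" where
  "nonzero_tuples k = ({1..k} \<rightarrow>\<^sub>E UNIV) - {zero_tuple k}"

definition J_solutions ::
    "nat \<Rightarrow> nat \<Rightarrow> real \<Rightarrow> (nat \<Rightarrow> int) \<Rightarrow> ((nat \<Rightarrow> int) \<times> (nat \<Rightarrow> int)) set" where
  "J_solutions s k X h =
    {(x, y). x \<in> {1..s} \<rightarrow>\<^sub>E {n. 1 \<le> n \<and> real_of_int n \<le> X} \<and>
             y \<in> {1..s} \<rightarrow>\<^sub>E {n. 1 \<le> n \<and> real_of_int n \<le> X} \<and>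
             (\<forall>j\<in>{1..k}. (\<Sum>i=1..s. x i ^ j - y i ^ j) = h j)}"

definition J :: "nat \<Rightarrow> nat \<Rightarrow> real \<Rightarrow> (nat \<Rightarrow> int) \<Rightarrow> nat" where
  "J s k X h = card (J_solutions s k X h)"

text \<open>
  The next three facts show that neither \<open>card\<close> above nor \<open>Max\<close> over \<open>nonzero_tuples k\<close> is
  applied to an infinite set, and that the latter set is nonempty for \<open>k \<ge> 1\<close>.
\<close>

lemma J_solutions_subset:
  "J_solutions s k X h \<subseteq> ({1..s} \<rightarrow>\<^sub>E {1..\<lfloor>X\<rfloor>}) \<times> ({1..s} \<rightarrow>\<^sub>E {1..\<lfloor>X\<rfloor>})"
proof -
  have "{n. 1 \<le> n \<and> real_of_int n \<le> X} = {1..\<lfloor>X\<rfloor>}"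
    by (auto simp: le_floor_iff)
  then show ?thesis
    unfolding J_solutions_def by auto
qed

lemma finite_J_solutions: "finite (J_solutions s k X h)"
  by (rule finite_subset[OF J_solutions_subset]) (intro finite_cartesian_product finite_PiE; simp)

lemma finite_J_image: "finite (J s k X ` H)"
proof -
  let ?B = "({1..s} \<rightarrow>\<^sub>E {1..\<lfloor>X\<rfloor>}) \<times> ({1..s} \<rightarrow>\<^sub>E {1..\<lfloor>X\<rfloor>})"
  have "finite ?B"
    by (intro finite_cartesian_product finite_PiE; simp)
  then have "J s k X ` H \<subseteq> {..card ?B}"
    unfolding J_def using card_mono[OF _ J_solutions_subset] by blast
  then show ?thesis
    by (rule finite_subset) simp
qed

lemma nonzero_tuples_nonempty:
  assumes "k \<ge> 1"
  shows "nonzero_tuples k \<noteq> {}"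
proof -
  have "(\<lambda>j\<in>{1..k}. 1) \<noteq> zero_tuple k"
    using assms by (auto simp: zero_tuple_def fun_eq_iff restrict_def intro!: exI[of _ 1])
  then have "(\<lambda>j\<in>{1..k}. 1) \<in> nonzero_tuples k"
    unfolding nonzero_tuples_def by simp
  then show ?thesis
    by blast
qed

end

theory Submission
  imports Defs
begin

text \<open>
  Fix one pair of variables to \<open>x = 2\<close>, \<open>y = 1\<close> and let the remaining \<open>s - 1\<close> pairs run over the
  diagonal \<open>x = y\<close>. Diagonal pairs contribute nothing to any of the power sums, so all these
  points solve the one system with right-hand side \<open>h\<^sub>j = 2 ^ j - 1\<close>, which is nonzero already
  at \<open>j = 1\<close>. There are \<open>\<lfloor>X\<rfloor> ^ (s - 1)\<close> such points (\<open>J_single_difference_ge\<close>), and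
  \<open>\<lfloor>X\<rfloor> \<ge> X / 2\<close> for \<open>X \<ge> 2\<close>, so \<open>(1 / 2) ^ (s - 1)\<close> serves as the implicit constant.
\<close>

text \<open>
  The solutions counted here are the extensions of diagonal points: a tuple \<open>f\<close> of length \<open>n\<close>
  gives \<open>x = (f, a)\<close> and \<open>y = (f, b)\<close>.
\<close>

lemma J_single_difference_ge:
  fixes a b :: int
  assumes a: "1 \<le> a" "real_of_int a \<le> X" and b: "1 \<le> b" "real_of_int b \<le> X"
  shows "nat \<lfloor>X\<rfloor> ^ n \<le> J (Suc n) k X (\<lambda>j\<in>{1..k}. a ^ j - b ^ j)"
proof -
  let ?h = "\<lambda>j\<in>{1..k}. a ^ j - b ^ j"
  let ?D = "{1..n} \<rightarrow>\<^sub>E {1..\<lfloor>X\<rfloor>}"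
  let ?g = "\<lambda>f :: nat \<Rightarrow> int. (f(Suc n := a), f(Suc n := b))"
  have extend: "f(Suc n := c) \<in> {1..Suc n} \<rightarrow>\<^sub>E {m. 1 \<le> m \<and> real_of_int m \<le> X}"
    if "f \<in> ?D" "1 \<le> c" "real_of_int c \<le> X" for f c
    using that by (auto simp: PiE_iff extensional_def le_Suc_eq le_floor_iff)
  have "?g ` ?D \<subseteq> J_solutions (Suc n) k X ?h"
  proof (rule image_subsetI)
    fix f assume f: "f \<in> ?D"
    have "(\<Sum>i=1..Suc n. (f(Suc n := a)) i ^ j - (f(Suc n := b)) i ^ j) = a ^ j - b ^ j" for j
    proof -
      have "(\<Sum>i=1..n. (f(Suc n := a)) i ^ j - (f(Suc n := b)) i ^ j) = 0"
        by (rule sum.neutral) auto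
      then show ?thesis
        by simp
    qed
    then show "?g f \<in> J_solutions (Suc n) k X ?h"
      unfolding J_solutions_def mem_Collect_eq case_prod_conv
      by (intro conjI ballI extend[OF f a] extend[OF f b]) (simp only: restrict_apply if_True)
  qed
  moreover have "inj_on ?g ?D"
  proof (rule inj_onI)
    fix f f' assume D: "f \<in> ?D" "f' \<in> ?D" and eq: "?g f = ?g f'"
    show "f = f'"
    proof
      fix i
      show "f i = f' i"
      proof (cases "i = Suc n")
        case True
        then show ?thesis
          using D[THEN PiE_arb, of i] by simp
      next
        case False
        have "(f(Suc n := a)) i = (f'(Suc n := a)) i"
          using eq by simp
        with False show ?thesis
          by simp
      qed
    qed
  qed
  ultimately have "card ?D \<le> J (Suc n) k X ?h"
    unfolding J_def by (intro card_inj_on_le[OF _ _ finite_J_solutions])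
  then show ?thesis
    by (simp add: card_PiE)
qed

theorem theorem7p1:
  fixes s k :: nat
  assumes "s \<ge> 1" and "k \<ge> 1"
  shows "(\<lambda>X::real. real (Max (J s k X ` nonzero_tuples k))) \<in> \<Omega>[at_top](\<lambda>X. X ^ (s - 1))"
proof -
  obtain n where s: "s = Suc n"
    using \<open>s \<ge> 1\<close> by (cases s) auto
  let ?h = "\<lambda>j\<in>{1..k}. (2 :: int) ^ j - 1 ^ j"
  have "?h 1 \<noteq> zero_tuple k 1"
    using \<open>k \<ge> 1\<close> by (simp add: zero_tuple_def)
  then have "?h \<noteq> zero_tuple k"
    by (rule contrapos_nn) (rule fun_cong)
  then have h: "?h \<in> nonzero_tuples k"
    unfolding nonzero_tuples_def by simp
  have bound: "(1 / 2) ^ n * X ^ n \<le> real (Max (J s k X ` nonzero_tuples k))"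
    if X: "X \<ge> 2" for X :: real
  proof -
    have "X / 2 \<le> real (nat \<lfloor>X\<rfloor>)"
      using X by linarith
    then have "(X / 2) ^ n \<le> real (nat \<lfloor>X\<rfloor>) ^ n"
      using X by (intro power_mono) auto
    also have "\<dots> = real (nat \<lfloor>X\<rfloor> ^ n)"
      by (rule of_nat_power[symmetric])
    also have "\<dots> \<le> real (J s k X ?h)"
      unfolding s using X by (intro of_nat_mono J_single_difference_ge) auto
    also have "\<dots> \<le> real (Max (J s k X ` nonzero_tuples k))"
      using h by (intro of_nat_mono Max_ge finite_J_image imageI)
    finally show ?thesis
      by (simp add: power_divide)
  qed
  have "eventually (\<lambda>X::real. (1 / 2) ^ n * norm (X ^ (s - 1))
          \<le> norm (real (Max (J s k X ` nonzero_tuples k)))) at_top"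
    using eventually_ge_at_top[of "2 :: real"]
  proof eventually_elim
    case (elim X)
    then show ?case
      using bound[of X] by (simp add: s)
  qed
  then show ?thesis
    by (intro landau_omega.bigI[of "(1 / 2) ^ n"]) auto
qed

end
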